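(* Let $L$ be a Lie superalgebra over a field of characteristic zero, and let $P\colon L\to L$ be an even (parity-preserving) linear map with $P^2=P$ such that for all $a,b\in L$ $$[Pa,Pb]=0\qquad\text{and}\qquad P[a,b]=P[Pa,b]+P[a,Pb].$$ Let $V=P(L)$ and let $\Delta\in L$ be an odd element with $\Delta^2:=\tfrac12[\Delta,\Delta]=0$. Then the derived brackets of $\Delta$, $$\{a_1,\ldots,a_n\}_\Delta:=P[\ldots[[\Delta,a_1],a_2],\ldots,a_n],\qquad a_i\in V,\ n=0,1,2,\ldots,$$ (for $n=0$: $\{\varnothing\}_\Delta:=P(\Delta)$) make $V$ an $L_\infty$-algebra.
   Context: All vector spaces are $\mathbb{Z}_2$-graded; $\tilde a\in\mathbb Z_2$ denotes the parity of a homogeneous element $a$. Formulas with signs are stated for homogeneous elements and extended by multilinearity. An $L_\infty$-algebra (strongly homotopy Lie algebra) here is a $\mathbb Z_2$-graded vector space $V=V_0\oplus V_1$ with a sequence of odd $n$-linear operations $\{\cdot,\ldots,\cdot\}$, $n=0,1,2,\ldots$ (the $0$-ary operation being a distinguished element $\{\varnothing\}\in V$, not required to vanish), such that: (a) all operations are symmetric in the $\mathbb Z_2$-graded sense: $\{a_1,\ldots,a_i,a_{i+1},\ldots,a_n\}=(-1)^{\tilde a_i\tilde a_{i+1}}\{a_1,\ldots,a_{i+1},a_i,\ldots,a_n\}$; (b) for all $n=0,1,2,\ldots$ the generalized Jacobi identity of order $n$ holds: $$\sum_{k+l=n}\ \sum_{(k,l)\text{-shuffles }\sigma}(-1)^{\alpha}\,\{\{a_{\sigma(1)},\ldots,a_{\sigma(k)}\},a_{\sigma(k+1)},\ldots,a_{\sigma(k+l)}\}=0,$$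 with $k,l\ge0$, where a $(k,l)$-shuffle is a permutation $\sigma$ of $1,\ldots,k+l$ with $\sigma(1)<\dots<\sigma(k)$ and $\sigma(k+1)<\dots<\sigma(k+l)$. The sign $(-1)^\alpha$ is the Koszul sign of the permutation $(a_1,\ldots,a_n)\mapsto(a_{\sigma(1)},\ldots,a_{\sigma(n)})$: a factor $(-1)^{\tilde a\tilde b}$ for every transposition of adjacent elements $a,b$, and no other signs. For $k=0$ the inner bracket is $\{\varnothing\}$. *)

theory Defs
  imports Complex_Main "HOL-Library.Z2" "HOL-Combinatorics.Permutations"
begin

text \<open>
  Parities are elements of \<^typ>\<open>bit\<close>, the field with two elements. A homogeneous element of
  parity \<open>p\<close> is a member of \<open>G p\<close>; zero is homogeneous of both parities.
\<close>

definition parity_sign :: "bit \<Rightarrow> 'k::field" where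
  "parity_sign p = (if p = 0 then 1 else - 1)"

locale super_vector_space = vector_space scale
  for scale :: "'k::field \<Rightarrow> 'v::ab_group_add \<Rightarrow> 'v" (infixr \<open>*s\<close> 75) +
  fixes V :: "'v set"
    and G :: "bit \<Rightarrow> 'v set"
  assumes subspace_carrier: "subspace V"
    and subspace_grade: "subspace (G p)"
    and grade_Int: "G 0 \<inter> G 1 = {0}"
    and grade_sum: "V = {x + y | x y. x \<in> G 0 \<and> y \<in> G 1}"

locale lie_superalgebra = super_vector_space scale UNIV G
  for scale :: "'k::field_char_0 \<Rightarrow> 'v::ab_group_add \<Rightarrow> 'v" (infixr \<open>*s\<close> 75)
    and G :: "bit \<Rightarrow> 'v set" +
  fixes br :: "'v \<Rightarrow> 'v \<Rightarrow> 'v"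
  assumes br_linear_left: "Vector_Spaces.linear scale scale (\<lambda>a. br a b)"
    and br_linear_right: "Vector_Spaces.linear scale scale (\<lambda>b. br a b)"
    and br_grade: "a \<in> G p \<Longrightarrow> b \<in> G q \<Longrightarrow> br a b \<in> G (p + q)"
    and br_antisym: "a \<in> G p \<Longrightarrow> b \<in> G q \<Longrightarrow> br a b = - (parity_sign (p * q) *s br b a)"
    and br_jacobi: "a \<in> G p \<Longrightarrow> b \<in> G q \<Longrightarrow> c \<in> G r \<Longrightarrow>
      br a (br b c) = br (br a b) c + parity_sign (p * q) *s br b (br a c)"

text \<open>
  Indices start at 0: a \<open>(k, l)\<close>-shuffle permutes \<open>{..<k + l}\<close>.
\<close>

definition shuffle_perms :: "nat \<Rightarrow> nat \<Rightarrow> (nat \<Rightarrow> nat) set" where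
  "shuffle_perms k l =
     {\<sigma>. \<sigma> permutes {..<k + l} \<and> strict_mono_on {..<k} \<sigma> \<and> strict_mono_on {k..<k + l} \<sigma>}"

text \<open>
  The exponent \<open>\<alpha>\<close> of the Koszul sign of \<open>(a\<^sub>0, \<dots>, a\<^sub>n\<^sub>-\<^sub>1) \<mapsto> (a\<^bsub>\<sigma> 0\<^esub>, \<dots>, a\<^bsub>\<sigma> (n - 1)\<^esub>)\<close>, where
  \<open>p i\<close> is the parity of \<open>a\<^sub>i\<close>: every pair of elements whose order is reversed contributes the product
  of its parities. The two lemmas below show that this is the exponent obtained by performing the
  permutation through transpositions of adjacent elements, each of which contributes the product of
  the parities of the two elements exchanged.
\<close>

definition koszul_exponent :: "nat \<Rightarrow> (nat \<Rightarrow> bit) \<Rightarrow> (nat \<Rightarrow> nat) \<Rightarrow> bit" where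
  "koszul_exponent n p \<sigma> = (\<Sum>(i, j) \<in> {(i, j). i < j \<and> j < n \<and> \<sigma> j < \<sigma> i}. p (\<sigma> i) * p (\<sigma> j))"

lemma koszul_exponent_id: "koszul_exponent n p id = 0"
proof -
  have eq: "{(i, j). i < j \<and> j < n \<and> id j < id i} = {}" by auto
  show ?thesis unfolding koszul_exponent_def eq by (rule sum.empty)
qed

lemma koszul_exponent_adjacent:
  assumes "\<sigma> permutes {..<n}" and "Suc i < n"
  shows "koszul_exponent n p (\<sigma> \<circ> transpose i (Suc i)) =
    koszul_exponent n p \<sigma> + p (\<sigma> i) * p (\<sigma> (Suc i))"
proof -
  let ?t = "transpose i (Suc i)"
  let ?\<tau> = "\<sigma> \<circ> ?t"
  define I where "I \<rho> = {(a, b). a < b \<and> b < n \<and> \<rho> b < (\<rho> a :: nat)}" for \<rho>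
  define f where "f \<rho> = (\<lambda>(a, b). p (\<rho> a) * p (\<rho> b))" for \<rho> :: "nat \<Rightarrow> nat"
  define e where "e = (i, Suc i)"
  have fin: "finite (I \<rho>)" for \<rho>
    by (rule finite_subset[of _ "{..<n} \<times> {..<n}"]) (auto simp: I_def)
  have less: "?t a < ?t b \<and> ?t b < n" if "a < b" "b < n" "(a, b) \<noteq> e" for a b
    using that assms(2) by (auto simp: e_def transpose_def)
  have ne_e: "(?t a, ?t b) \<noteq> e" if "a < b" for a b
    using that by (auto simp: e_def transpose_def split: if_splits)
  have bij: "bij_betw (map_prod ?t ?t) (I \<sigma> - {e}) (I ?\<tau> - {e})"
  proof (rule bij_betw_byWitness[where f' = "map_prod ?t ?t"])
    show "map_prod ?t ?t ` (I \<sigma> - {e}) \<subseteq> I ?\<tau> - {e}"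
    proof
      fix z assume "z \<in> map_prod ?t ?t ` (I \<sigma> - {e})"
      then obtain a b where z: "z = (?t a, ?t b)" and ab: "a < b" "b < n" "\<sigma> b < \<sigma> a" "(a, b) \<noteq> e"
        unfolding I_def by blast
      show "z \<in> I ?\<tau> - {e}"
        using less[OF ab(1,2,4)] ne_e[OF ab(1)] ab(3) unfolding z I_def by simp
    qed
    show "map_prod ?t ?t ` (I ?\<tau> - {e}) \<subseteq> I \<sigma> - {e}"
    proof
      fix z assume "z \<in> map_prod ?t ?t ` (I ?\<tau> - {e})"
      then obtain a b where z: "z = (?t a, ?t b)" and ab: "a < b" "b < n" "?\<tau> b < ?\<tau> a" "(a, b) \<noteq> e"
        unfolding I_def by blast
      show "z \<in> I \<sigma> - {e}"
        using less[OF ab(1,2,4)] ne_e[OF ab(1)] ab(3) unfolding z I_def by simp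
    qed
  qed auto
  have rest: "sum (f ?\<tau>) (I ?\<tau> - {e}) = sum (f \<sigma>) (I \<sigma> - {e})"
    by (rule sum.reindex_bij_betw[OF bij, symmetric, THEN trans])
      (simp add: f_def case_prod_beta)
  have split: "sum (f \<rho>) (I \<rho>) = (if e \<in> I \<rho> then f \<rho> e else 0) + sum (f \<rho>) (I \<rho> - {e})" for \<rho>
    using fin[of \<rho>] by (simp add: sum.remove)
  have ne: "\<sigma> i \<noteq> \<sigma> (Suc i)"
    by (simp add: inj_eq[OF permutes_inj[OF assms(1)]])
  have dbl: "x + x = 0" for x :: bit by (cases x) auto
  have f_e: "f \<sigma> e = p (\<sigma> i) * p (\<sigma> (Suc i))" "f ?\<tau> e = f \<sigma> e"
    by (simp_all add: f_def e_def mult.commute del: mult_bit_eq_and)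
  have "sum (f ?\<tau>) (I ?\<tau>) = sum (f \<sigma>) (I \<sigma>) + f \<sigma> e"
  proof (cases "\<sigma> i < \<sigma> (Suc i)")
    case True
    then have "e \<notin> I \<sigma>" "e \<in> I ?\<tau>"
      using assms(2) by (simp_all add: I_def e_def)
    then show ?thesis
      unfolding split[of ?\<tau>] split[of \<sigma>] rest f_e(2) by (simp only: if_True if_False add_0 add.commute)
  next
    case False
    then have "e \<in> I \<sigma>" "e \<notin> I ?\<tau>"
      using assms(2) ne by (simp_all add: I_def e_def)
    then show ?thesis
      unfolding split[of ?\<tau>] split[of \<sigma>] rest
      by (simp only: if_True if_False add_0 add.assoc[symmetric] add.commute[of _ "f \<sigma> e"] dbl)
  qed
  then show ?thesis
    unfolding f_e(1) unfolding koszul_exponent_def I_def f_def .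
qed

text \<open>
  The \<open>n\<close>-ary operation is \<open>br\<close> restricted to lists of length \<open>n\<close> over \<open>V\<close>; values of \<open>br\<close> on other
  lists are irrelevant. Oddness of the operation for \<open>n = 0\<close> means \<open>br [] \<in> G 1\<close>.
\<close>

locale L_infinity_algebra = super_vector_space scale V G
  for scale :: "'k::field \<Rightarrow> 'v::ab_group_add \<Rightarrow> 'v" (infixr \<open>*s\<close> 75)
    and V :: "'v set"
    and G :: "bit \<Rightarrow> 'v set" +
  fixes br :: "'v list \<Rightarrow> 'v"
  assumes br_closed: "set as \<subseteq> V \<Longrightarrow> br as \<in> V"
    and br_add: "set as \<subseteq> V \<Longrightarrow> x \<in> V \<Longrightarrow> y \<in> V \<Longrightarrow> set bs \<subseteq> V \<Longrightarrow>
      br (as @ (x + y) # bs) = br (as @ x # bs) + br (as @ y # bs)"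
    and br_scale: "set as \<subseteq> V \<Longrightarrow> x \<in> V \<Longrightarrow> set bs \<subseteq> V \<Longrightarrow>
      br (as @ (c *s x) # bs) = c *s br (as @ x # bs)"
    and br_odd: "list_all2 (\<lambda>a p. a \<in> G p) as ps \<Longrightarrow> br as \<in> G (sum_list ps + 1)"
    and br_symmetric: "set as \<subseteq> V \<Longrightarrow> x \<in> G p \<Longrightarrow> y \<in> G q \<Longrightarrow> set bs \<subseteq> V \<Longrightarrow>
      br (as @ x # y # bs) = parity_sign (p * q) *s br (as @ y # x # bs)"
    and br_jacobi: "list_all2 (\<lambda>a p. a \<in> G p) as ps \<Longrightarrow> length as = n \<Longrightarrow>
      (\<Sum>k\<le>n. \<Sum>\<sigma>\<in>shuffle_perms k (n - k).
         parity_sign (koszul_exponent n ((!) ps) \<sigma>) *s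
           br (br (map (\<lambda>i. as ! \<sigma> i) [0..<k]) # map (\<lambda>i. as ! \<sigma> i) [k..<n])) = 0"

definition derived_bracket :: "('v \<Rightarrow> 'v) \<Rightarrow> ('v \<Rightarrow> 'v \<Rightarrow> 'v) \<Rightarrow> 'v \<Rightarrow> 'v list \<Rightarrow> 'v" where
  "derived_bracket P br \<Delta> as = P (foldl br \<Delta> as)"

end

theory Submission
  imports Defs
begin

text \<open>
  Write \<open>\<Delta>\<^bsub>S\<^esub>\<close> for the bracket of \<open>\<Delta>\<close> with the elements \<open>a\<^sub>i\<close>, \<open>i \<in> S\<close>, taken from the right in
  increasing order of \<open>i\<close>. The Jacobi identity of order \<open>n\<close> is a relation between the elements
  \<open>P[P\<Delta>\<^bsub>S\<^esub>, \<Delta>\<^bsub>T\<^esub>]\<close> for the partitions of the index set into \<open>S\<close> and \<open>T\<close>, and it follows from expanding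
  \<open>P[\<dots>[[\<Delta>, \<Delta>], a\<^sub>0], \<dots>, a\<^sub>n\<^sub>-\<^sub>1] = 0\<close>.

  Bracketing from the right is a graded derivation of the Lie bracket, so the expression is the signed
  sum of all \<open>P[\<Delta>\<^bsub>S\<^esub>, \<Delta>\<^bsub>T\<^esub>]\<close> (lemma \<open>foldl_br_br\<close>). The identity assumed of \<open>P\<close> turns each summand into
  \<open>P[P\<Delta>\<^bsub>S\<^esub>, \<Delta>\<^bsub>T\<^esub>] + P[\<Delta>\<^bsub>S\<^esub>, P\<Delta>\<^bsub>T\<^esub>]\<close>. By antisymmetry the second term is, up to sign, the first term of
  the partition with \<open>S\<close> and \<open>T\<close> exchanged, and the signs match (lemmas \<open>P_br_homogeneous\<close> and
  \<open>crossing_exponent_swap\<close>). The total is therefore twice the signed sum of the \<open>P[P\<Delta>\<^bsub>S\<^esub>, \<Delta>\<^bsub>T\<^esub>]\<close>, and this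
  sum vanishes because \<open>2\<close> is invertible.

  On the other side, a nested derived bracket starts from \<open>[\<Delta>, P\<Delta>\<^bsub>S\<^esub>] = \<plusminus>[P\<Delta>\<^bsub>S\<^esub>, \<Delta>]\<close>. Since \<open>P\<Delta>\<^bsub>S\<^esub>\<close>
  commutes with all \<open>a\<^sub>i\<close>, further brackets act on the second factor only, which gives
  \<open>\<plusminus>P[P\<Delta>\<^bsub>S\<^esub>, \<Delta>\<^bsub>T\<^esub>]\<close> (lemma \<open>derived_bracket_nested\<close>). So the vanishing sum is the Jacobi expression.

  The sum over shuffles is handled as a sum over subsets \<open>S\<close>, since a shuffle is determined by the set
  of entries that it puts first; subsets of \<open>{..<n}\<close> admit the recursion on \<open>n\<close> that matches the
  derivation rule (lemma \<open>sum_shuffles_eq_sum_subsets\<close>). Graded symmetry of the derived brackets is the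
  derivation rule again, applied to two elements that commute.
\<close>

lemma parity_sign_0: "parity_sign 0 = 1"
  by (simp add: parity_sign_def)

lemma parity_sign_add: "parity_sign (p + q) = parity_sign p * parity_sign q"
  by (cases p; cases q) (simp_all add: parity_sign_def)

lemma bit_add_self: "x + x = (0 :: bit)"
  by (cases x) simp_all

section \<open>Shuffles and subsets\<close>

text \<open>
  The Koszul exponent of moving the entries with index in \<open>S\<close> in front of those with index in \<open>T\<close>,
  each group keeping its internal order.
\<close>

definition crossing_exponent :: "(nat \<Rightarrow> bit) \<Rightarrow> nat set \<Rightarrow> nat set \<Rightarrow> bit" where
  "crossing_exponent p S T = (\<Sum>(i, j) \<in> {(i, j). i \<in> S \<and> j \<in> T \<and> j < i}. p i * p j)"

lemma finite_crossings: "finite S \<Longrightarrow> finite T \<Longrightarrow> finite {(i, j). i \<in> S \<and> j \<in> T \<and> j < (i::nat)}"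
  by (rule finite_subset[of _ "S \<times> T"]) auto

text \<open>
  Each pair in \<open>S \<times> T\<close> is crossed in exactly one of the two rearrangements.
\<close>

lemma crossing_exponent_swap:
  assumes "finite S" "finite T" "S \<inter> T = {}"
  shows "crossing_exponent p S T + crossing_exponent p T S = sum p S * sum p T"
proof -
  let ?f = "\<lambda>(i, j). p i * p j"
  let ?A = "{(i, j). i \<in> S \<and> j \<in> T \<and> j < i}" and ?B = "{(i, j). i \<in> S \<and> j \<in> T \<and> i < j}"
  have swap: "crossing_exponent p T S = sum ?f ?B"
    unfolding crossing_exponent_def
    by (rule sum.reindex_bij_witness[of _ prod.swap prod.swap])
      (auto simp: mult.commute simp del: mult_bit_eq_and)
  have "sum p S * sum p T = sum ?f (S \<times> T)"
    by (simp only: sum_product sum.cartesian_product)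
  also have "S \<times> T = ?A \<union> ?B"
    using assms(3) by (auto simp: not_less le_less)
  also have "sum ?f \<dots> = sum ?f ?A + sum ?f ?B"
    using assms by (intro sum.union_disjoint) (auto intro: finite_subset[of _ "S \<times> T"])
  finally show ?thesis
    unfolding swap by (simp only: crossing_exponent_def)
qed

lemma crossing_exponent_insert_right:
  assumes "\<And>i. i \<in> S \<Longrightarrow> i < n"
  shows "crossing_exponent p S (insert n T) = crossing_exponent p S T"
  unfolding crossing_exponent_def
  by (rule arg_cong[of _ _ "sum _"]) (use assms in force)

lemma crossing_exponent_insert_left:
  assumes "finite S" "finite T" "\<And>i. i \<in> S \<Longrightarrow> i < n" "\<And>j. j \<in> T \<Longrightarrow> j < n"
  shows "crossing_exponent p (insert n S) T = crossing_exponent p S T + p n * sum p T"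
proof -
  let ?f = "\<lambda>(i, j). p i * p j"
  let ?A = "{(i, j). i \<in> S \<and> j \<in> T \<and> j < i}"
  have "{(i, j). i \<in> insert n S \<and> j \<in> T \<and> j < i} = ?A \<union> Pair n ` T"
    using assms(3,4) by auto
  moreover have "sum ?f (?A \<union> Pair n ` T) = sum ?f ?A + sum ?f (Pair n ` T)"
    using assms finite_crossings[OF assms(1,2)] by (intro sum.union_disjoint) auto
  moreover have "sum ?f (Pair n ` T) = p n * sum p T"
    by (subst sum.reindex) (auto simp: inj_on_def sum_distrib_left simp del: mult_bit_eq_and)
  ultimately show ?thesis
    unfolding crossing_exponent_def by (simp only:)
qed

lemma shuffle_image_compl:
  assumes "\<sigma> \<in> shuffle_perms k l"
  shows "\<sigma> ` {k..<k + l} = {..<k + l} - \<sigma> ` {..<k}"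
proof -
  have p: "\<sigma> permutes {..<k + l}" using assms by (simp add: shuffle_perms_def)
  have "{k..<k + l} = {..<k + l} - {..<k}" by auto
  then show ?thesis
    using image_set_diff[OF permutes_inj[OF p], of "{..<k + l}" "{..<k}"] permutes_image[OF p]
    by simp
qed

lemma shuffle_map_first:
  assumes "\<sigma> \<in> shuffle_perms k l"
  shows "map \<sigma> [0..<k] = sorted_list_of_set (\<sigma> ` {..<k})"
proof -
  have "strict_mono_on {..<k} \<sigma>" using assms by (simp add: shuffle_perms_def)
  then have "sorted_wrt (<) (map \<sigma> [0..<k])"
    by (auto simp: sorted_wrt_iff_nth_less strict_mono_on_def)
  then show ?thesis
    by (intro strict_sorted_equal) (auto simp: atLeast0LessThan)
qed

lemma shuffle_map_second:
  assumes "\<sigma> \<in> shuffle_perms k l"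
  shows "map \<sigma> [k..<k + l] = sorted_list_of_set ({..<k + l} - \<sigma> ` {..<k})"
proof -
  have "strict_mono_on {k..<k + l} \<sigma>" using assms by (simp add: shuffle_perms_def)
  then have "sorted_wrt (<) (map \<sigma> [k..<k + l])"
    by (auto simp: sorted_wrt_iff_nth_less strict_mono_on_def)
  moreover have "set (map \<sigma> [k..<k + l]) = {..<k + l} - \<sigma> ` {..<k}"
    using shuffle_image_compl[OF assms] by simp
  ultimately show ?thesis
    by (intro strict_sorted_equal) (auto simp del: set_map)
qed

text \<open>
  A shuffle is increasing on both blocks of positions, so every inversion has its left position in the
  first block and its right position in the second.
\<close>

lemma koszul_exponent_shuffle:
  assumes "\<sigma> \<in> shuffle_perms k l"
  shows "koszul_exponent (k + l) p \<sigma> = crossing_exponent p (\<sigma> ` {..<k}) ({..<k + l} - \<sigma> ` {..<k})"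
proof -
  have perm: "\<sigma> permutes {..<k + l}" and m1: "strict_mono_on {..<k} \<sigma>"
    and m2: "strict_mono_on {k..<k + l} \<sigma>"
    using assms by (auto simp: shuffle_perms_def)
  have inv: "{(i, j). i < j \<and> j < k + l \<and> \<sigma> j < \<sigma> i} =
      {(i, j). i < k \<and> k \<le> j \<and> j < k + l \<and> \<sigma> j < \<sigma> i}" (is "_ = ?I")
  proof -
    have "i < k \<and> k \<le> j" if "i < j" "j < k + l" "\<sigma> j < \<sigma> i" for i j
      using that strict_mono_onD[OF m1, of i j] strict_mono_onD[OF m2, of i j]
      by (metis atLeastLessThan_iff lessThan_iff less_trans not_le order_less_asym)
    then show ?thesis by auto
  qed
  have inj: "inj \<sigma>" using perm by (rule permutes_inj)
  have img: "map_prod \<sigma> \<sigma> ` ?I =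
      {(i, j). i \<in> \<sigma> ` {..<k} \<and> j \<in> \<sigma> ` {k..<k + l} \<and> j < i}"
    by (force simp: image_iff)
  have "koszul_exponent (k + l) p \<sigma> = (\<Sum>x\<in>?I. (\<lambda>(i, j). p i * p j) (map_prod \<sigma> \<sigma> x))"
    unfolding koszul_exponent_def inv by (rule sum.cong) auto
  also have "\<dots> = (\<Sum>(i, j)\<in>map_prod \<sigma> \<sigma> ` ?I. p i * p j)"
    by (rule sum.reindex[symmetric, unfolded o_def])
      (use prod.inj_map[OF inj inj] in \<open>rule inj_on_subset, simp\<close>)
  finally show ?thesis
    unfolding img crossing_exponent_def shuffle_image_compl[OF assms] .
qed

text \<open>
  The inverse sends \<open>S\<close> to the permutation that lists \<open>S\<close> and then its complement, both in
  increasing order.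
\<close>

lemma shuffles_bij_betw_subsets:
  "bij_betw (\<lambda>(k, \<sigma>). \<sigma> ` {..<k}) (SIGMA k:{..n}. shuffle_perms k (n - k)) (Pow {..<n})"
proof (rule bij_betw_imageI)
  show "inj_on (\<lambda>(k, \<sigma>). \<sigma> ` {..<k}) (SIGMA k:{..n}. shuffle_perms k (n - k))"
  proof (rule inj_onI, clarsimp)
    fix k \<sigma> k' \<tau>
    assume k: "k \<le> n" "k' \<le> n" and \<sigma>: "\<sigma> \<in> shuffle_perms k (n - k)"
      and \<tau>: "\<tau> \<in> shuffle_perms k' (n - k')" and eq: "\<sigma> ` {..<k} = \<tau> ` {..<k'}"
    have p: "\<sigma> permutes {..<n}" "\<tau> permutes {..<n}"
      using \<sigma> \<tau> k by (auto simp: shuffle_perms_def)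
    have "card (\<sigma> ` {..<k}) = k" "card (\<tau> ` {..<k'}) = k'"
      using p by (auto simp: card_image permutes_inj_on)
    with eq have kk: "k' = k" by simp
    have "map \<sigma> [0..<k] = map \<tau> [0..<k]" "map \<sigma> [k..<n] = map \<tau> [k..<n]"
      using shuffle_map_first[OF \<sigma>] shuffle_map_first[OF \<tau>] shuffle_map_second[OF \<sigma>]
        shuffle_map_second[OF \<tau>] eq k unfolding kk by simp_all
    then have "\<sigma> i = \<tau> i" if "i < n" for i
      using that by (cases "i < k") auto
    moreover have "\<sigma> i = \<tau> i" if "\<not> i < n" for i
      using p that by (simp add: permutes_def)
    ultimately show "k = k' \<and> \<sigma> = \<tau>" using kk by blast
  qed
  show "(\<lambda>(k, \<sigma>). \<sigma> ` {..<k}) ` (SIGMA k:{..n}. shuffle_perms k (n - k)) = Pow {..<n}"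
  proof (intro equalityI subsetI)
    fix S assume "S \<in> (\<lambda>(k, \<sigma>). \<sigma> ` {..<k}) ` (SIGMA k:{..n}. shuffle_perms k (n - k))"
    then obtain k \<sigma> where "k \<le> n" "\<sigma> permutes {..<n}" "S = \<sigma> ` {..<k}"
      by (auto simp: shuffle_perms_def)
    then show "S \<in> Pow {..<n}"
      using permutes_image[of \<sigma> "{..<n}"] by auto
  next
    fix S assume "S \<in> Pow {..<n}"
    then have S: "S \<subseteq> {..<n}" by simp
    then have fin: "finite S" by (rule finite_subset) simp
    define xs where "xs = sorted_list_of_set S"
    define ys where "ys = sorted_list_of_set ({..<n} - S)"
    define k where "k = card S"
    define \<sigma> where "\<sigma> i = (if i < n then (xs @ ys) ! i else i)" for i
    have kn: "k \<le> n" using card_mono[OF _ S] by (simp add: k_def)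
    have lx: "length xs = k" and sx: "set xs = S" and mx: "sorted_wrt (<) xs"
      using fin by (simp_all add: xs_def k_def)
    have ly: "length ys = n - k" and sy: "set ys = {..<n} - S" and my: "sorted_wrt (<) ys"
      using S fin by (simp_all add: ys_def k_def card_Diff_subset)
    have dist: "distinct (xs @ ys)"
      using fin sx sy by (auto simp: xs_def ys_def)
    have "bij_betw ((!) (xs @ ys)) {..<n} {..<n}"
      by (rule bij_betw_nth[OF dist]) (use lx ly kn sx sy S in auto)
    then have "bij_betw \<sigma> {..<n} {..<n}"
      by (rule bij_betw_cong[THEN iffD1, rotated]) (simp add: \<sigma>_def)
    then have perm: "\<sigma> permutes {..<n}"
      by (rule bij_imp_permutes) (simp add: \<sigma>_def)
    have "strict_mono_on {..<k} \<sigma>"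
      using mx lx kn by (auto simp: strict_mono_on_def \<sigma>_def nth_append sorted_wrt_iff_nth_less)
    moreover have "strict_mono_on {k..<n} \<sigma>"
      using my lx ly kn by (auto simp: strict_mono_on_def \<sigma>_def nth_append sorted_wrt_iff_nth_less)
    ultimately have "\<sigma> \<in> shuffle_perms k (n - k)"
      using perm kn by (simp add: shuffle_perms_def)
    moreover have "\<sigma> ` {..<k} = S"
    proof -
      have "\<sigma> ` {..<k} = (!) xs ` {..<length xs}"
        using lx kn by (intro image_cong) (auto simp: \<sigma>_def nth_append)
      then show ?thesis by (simp add: sx[symmetric] set_conv_nth image_def) blast
    qed
    ultimately show "S \<in> (\<lambda>(k, \<sigma>). \<sigma> ` {..<k}) ` (SIGMA k:{..n}. shuffle_perms k (n - k))"
      using kn by (intro image_eqI[of _ _ "(k, \<sigma>)"]) auto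
  qed
qed

lemma sum_shuffles_eq_sum_subsets:
  fixes F :: "bit \<Rightarrow> nat list \<Rightarrow> nat list \<Rightarrow> 'b::comm_monoid_add"
  shows "(\<Sum>k\<le>n. \<Sum>\<sigma>\<in>shuffle_perms k (n - k).
      F (koszul_exponent n p \<sigma>) (map \<sigma> [0..<k]) (map \<sigma> [k..<n])) =
    (\<Sum>S\<in>Pow {..<n}. F (crossing_exponent p S ({..<n} - S))
      (sorted_list_of_set S) (sorted_list_of_set ({..<n} - S)))"
proof -
  have fin: "finite (shuffle_perms k (n - k))" for k
    by (rule finite_subset[OF _ finite_permutations[of "{..<k + (n - k)}"]])
      (auto simp: shuffle_perms_def)
  have "F (koszul_exponent n p \<sigma>) (map \<sigma> [0..<k]) (map \<sigma> [k..<n]) =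
      F (crossing_exponent p (\<sigma> ` {..<k}) ({..<n} - \<sigma> ` {..<k}))
        (sorted_list_of_set (\<sigma> ` {..<k})) (sorted_list_of_set ({..<n} - \<sigma> ` {..<k}))"
    if "k \<le> n" "\<sigma> \<in> shuffle_perms k (n - k)" for k \<sigma>
    using koszul_exponent_shuffle[OF that(2), of p] shuffle_map_first[OF that(2)]
      shuffle_map_second[OF that(2)] that(1) by simp
  then show ?thesis
    unfolding sum.reindex_bij_betw[OF shuffles_bij_betw_subsets, symmetric]
    by (subst sum.Sigma) (auto simp: fin intro!: sum.cong)
qed

lemma sum_Pow_lessThan_Suc:
  fixes f :: "nat set \<Rightarrow> 'b::comm_monoid_add"
  shows "sum f (Pow {..<Suc n}) = (\<Sum>S\<in>Pow {..<n}. f S + f (insert n S))"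
proof -
  have inj: "inj_on (insert n) (Pow {..<n})"
    by (auto simp: inj_on_def)
  have "sum f (Pow {..<Suc n}) = sum f (Pow {..<n}) + sum f (insert n ` Pow {..<n})"
    unfolding lessThan_Suc Pow_insert by (rule sum.union_disjoint) auto
  then show ?thesis
    by (simp add: sum.reindex[OF inj] sum.distrib)
qed

lemma sorted_list_of_set_insert_greater:
  fixes n :: nat
  assumes "S \<subseteq> {..<n}"
  shows "sorted_list_of_set (insert n S) = sorted_list_of_set S @ [n]"
proof -
  have "finite S" using assms by (rule finite_subset) simp
  moreover have "n \<notin> S" "\<forall>x\<in>S. x \<le> n" using assms by auto
  ultimately show ?thesis by (simp add: sorted_insort_is_snoc)
qed

section \<open>Iterated brackets in a Lie superalgebra\<close>

context lie_superalgebra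
begin

lemma
  br_add_left: "br (x + y) b = br x b + br y b" and
  br_scale_left: "br (c *s x) b = c *s br x b" and
  br_sum_left: "br (sum f A) b = (\<Sum>x\<in>A. br (f x) b)" and
  br_zero_left: "br 0 b = 0"
proof -
  have h: "module_hom scale scale (\<lambda>a. br a b)"
    using br_linear_left[of b] by (simp only: linear_iff_module_hom)
  show "br (x + y) b = br x b + br y b" by (rule module_hom.add[OF h])
  show "br (c *s x) b = c *s br x b" by (rule module_hom.scale[OF h])
  show "br (sum f A) b = (\<Sum>x\<in>A. br (f x) b)" by (rule module_hom.sum[OF h])
  show "br 0 b = 0" by (rule module_hom.zero[OF h])
qed

lemma
  br_add_right: "br a (x + y) = br a x + br a y" and
  br_scale_right: "br a (c *s x) = c *s br a x"
proof -
  have h: "module_hom scale scale (br a)"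
    using br_linear_right[of a] by (simp only: linear_iff_module_hom)
  show "br a (x + y) = br a x + br a y" by (rule module_hom.add[OF h])
  show "br a (c *s x) = c *s br a x" by (rule module_hom.scale[OF h])
qed

lemma homogeneous_decomposition: obtains x0 x1 where "x = x0 + x1" "x0 \<in> G 0" "x1 \<in> G 1"
  using grade_sum by blast

text \<open>
  The Jacobi identity read as: bracketing with \<open>c\<close> from the right is a graded derivation. In this form
  no sign involves the first entry, which may therefore be inhomogeneous.
\<close>

lemma br_br_right:
  assumes "b \<in> G q" "c \<in> G r"
  shows "br (br a b) c = br a (br b c) + parity_sign (q * r) *s br (br a c) b"
proof -
  have hom: "br (br a b) c = br a (br b c) + parity_sign (q * r) *s br (br a c) b"
    if "a \<in> G p" for a p
  proof -
    have "br b (br a c) = - (parity_sign (q * (p + r)) *s br (br a c) b)"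
      by (rule br_antisym[OF assms(1) br_grade[OF that assms(2)]])
    moreover have "parity_sign (p * q) * parity_sign (q * (p + r)) = (parity_sign (q * r) :: 'k)"
      by (cases p; cases q; cases r) (simp_all add: parity_sign_def)
    ultimately show ?thesis
      using br_jacobi[OF that assms] by simp
  qed
  obtain a0 a1 where a: "a = a0 + a1" "a0 \<in> G 0" "a1 \<in> G 1"
    by (rule homogeneous_decomposition)
  show ?thesis
    unfolding a(1) by (simp add: br_add_left scale_right_distrib hom[OF a(2)] hom[OF a(3)])
qed

lemma foldl_br_add: "foldl br (x + y) as = foldl br x as + foldl br y as"
  by (induction as arbitrary: x y) (simp_all add: br_add_left)

lemma foldl_br_scale: "foldl br (c *s x) as = c *s foldl br x as"
  by (induction as arbitrary: x) (simp_all add: br_scale_left)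

lemma foldl_br_zero: "foldl br 0 as = 0"
  by (induction as) (simp_all add: br_zero_left)

lemma foldl_br_grade:
  "list_all2 (\<lambda>a p. a \<in> G p) as ps \<Longrightarrow> x \<in> G q \<Longrightarrow> foldl br x as \<in> G (q + sum_list ps)"
proof (induction as ps arbitrary: x q rule: list_all2_induct)
  case (Cons a as p ps)
  from Cons.IH[OF br_grade[OF Cons.prems Cons.hyps(1)]] show ?case
    by (simp add: add.assoc del: add_bit_eq_xor)
qed (simp del: add_bit_eq_xor)

definition bracket_along :: "(nat \<Rightarrow> 'v) \<Rightarrow> 'v \<Rightarrow> nat set \<Rightarrow> 'v" where
  "bracket_along a x S = foldl br x (map a (sorted_list_of_set S))"

lemma bracket_along_insert:
  "S \<subseteq> {..<n} \<Longrightarrow> bracket_along a x (insert n S) = br (bracket_along a x S) (a n)"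
  by (simp add: bracket_along_def sorted_list_of_set_insert_greater)

lemma bracket_along_grade:
  assumes "finite S" "\<And>i. i \<in> S \<Longrightarrow> a i \<in> G (p i)" "x \<in> G q"
  shows "bracket_along a x S \<in> G (q + sum p S)"
proof -
  have "list_all2 (\<lambda>a p. a \<in> G p) (map a (sorted_list_of_set S)) (map p (sorted_list_of_set S))"
    using assms(1,2) by (simp add: list_all2_map1 list_all2_map2 list_all2_same)
  from foldl_br_grade[OF this assms(3)] show ?thesis
    using assms(1) by (simp add: bracket_along_def sum_list_distinct_conv_sum_set del: add_bit_eq_xor)
qed

text \<open>
  The iterated graded Leibniz rule. Each \<open>a\<^sub>i\<close> goes either to \<open>x\<close> or to \<open>y\<close>; those that go to \<open>x\<close> pass
  \<open>y\<close>, which gives \<open>q * sum p S\<close>, and the earlier entries that went to \<open>y\<close>, which gives the crossing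
  exponent.
\<close>

lemma foldl_br_br:
  assumes "\<And>i. i < n \<Longrightarrow> a i \<in> G (p i)" "y \<in> G q"
  shows "foldl br (br x y) (map a [0..<n]) =
    (\<Sum>S\<in>Pow {..<n}. parity_sign (crossing_exponent p S ({..<n} - S) + q * sum p S) *s
      br (bracket_along a x S) (bracket_along a y ({..<n} - S)))"
  using assms(1)
proof (induction n)
  case 0
  show ?case
    by (simp add: bracket_along_def crossing_exponent_def parity_sign_0)
next
  case (Suc n)
  let ?e = "\<lambda>n S. parity_sign (crossing_exponent p S ({..<n} - S) + q * sum p S) :: 'k"
  let ?X = "bracket_along a x" and ?Y = "bracket_along a y"
  have "foldl br (br x y) (map a [0..<Suc n]) = br (foldl br (br x y) (map a [0..<n])) (a n)"
    by simp
  also have "\<dots> = (\<Sum>S\<in>Pow {..<n}. ?e n S *s br (br (?X S) (?Y ({..<n} - S))) (a n))"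
    by (subst Suc.IH)
      (auto simp: Suc.prems br_sum_left br_scale_left simp del: add_bit_eq_xor mult_bit_eq_and)
  also have "\<dots> = (\<Sum>S\<in>Pow {..<n}. ?e (Suc n) S *s br (?X S) (?Y ({..<Suc n} - S)) +
      ?e (Suc n) (insert n S) *s br (?X (insert n S)) (?Y ({..<Suc n} - insert n S)))"
  proof (rule sum.cong[OF refl])
    fix S assume "S \<in> Pow {..<n}"
    then have S: "S \<subseteq> {..<n}" by simp
    then have fin: "finite S" by (rule finite_subset) simp
    define T where "T = {..<n} - S"
    have T: "T \<subseteq> {..<n}" "finite T" by (auto simp: T_def)
    have diff: "{..<Suc n} - S = insert n T" "{..<Suc n} - insert n S = T"
      using S by (auto simp: T_def less_Suc_eq)
    have e1: "?e (Suc n) S = ?e n S"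
      unfolding diff T_def[symmetric] by (subst crossing_exponent_insert_right) (use S in auto)
    have "crossing_exponent p (insert n S) T = crossing_exponent p S T + p n * sum p T"
      by (rule crossing_exponent_insert_left) (use S T fin in auto)
    moreover have "sum p (insert n S) = p n + sum p S"
      using S fin by (subst sum.insert) auto
    ultimately have e2: "?e (Suc n) (insert n S) = ?e n S * parity_sign ((q + sum p T) * p n)"
      unfolding diff T_def[symmetric]
      by (simp only: parity_sign_add[symmetric] algebra_simps)
    have "?Y T \<in> G (q + sum p T)"
      by (rule bracket_along_grade) (use T Suc.prems assms(2) in auto)
    then have "br (br (?X S) (?Y T)) (a n) = br (?X S) (br (?Y T) (a n)) +
        parity_sign ((q + sum p T) * p n) *s br (br (?X S) (a n)) (?Y T)"
      by (rule br_br_right) (simp add: Suc.prems)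
    then show "?e n S *s br (br (?X S) (?Y ({..<n} - S))) (a n) =
      ?e (Suc n) S *s br (?X S) (?Y ({..<Suc n} - S)) +
      ?e (Suc n) (insert n S) *s br (?X (insert n S)) (?Y ({..<Suc n} - insert n S))"
      unfolding e1 e2 unfolding diff bracket_along_insert[OF S] bracket_along_insert[OF T(1)]
        T_def[symmetric]
      by (simp only: scale_right_distrib scale_scale)
  qed
  also have "\<dots> = (\<Sum>S\<in>Pow {..<Suc n}. ?e (Suc n) S *s br (?X S) (?Y ({..<Suc n} - S)))"
    by (rule sum_Pow_lessThan_Suc[symmetric])
  finally show ?case .
qed

end

section \<open>Derived brackets\<close>

text \<open>
  For an idempotent \<open>P\<close> the last two conditions say that the image of \<open>P\<close> is an abelian subalgebra and
  the kernel of \<open>P\<close> is a subalgebra.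
\<close>

locale abelian_image_map = lie_superalgebra scale G br
  for scale :: "'k::field_char_0 \<Rightarrow> 'v::ab_group_add \<Rightarrow> 'v" (infixr \<open>*s\<close> 75)
    and G :: "bit \<Rightarrow> 'v set" and br :: "'v \<Rightarrow> 'v \<Rightarrow> 'v" +
  fixes P :: "'v \<Rightarrow> 'v"
  assumes P_linear: "Vector_Spaces.linear scale scale P"
    and P_grade: "x \<in> G p \<Longrightarrow> P x \<in> G p"
    and br_P_P: "br (P a) (P b) = 0"
    and P_br: "P (br a b) = P (br (P a) b) + P (br a (P b))"
begin

lemma
  P_add: "P (x + y) = P x + P y" and
  P_scale: "P (c *s x) = c *s P x" and
  P_sum: "P (sum f A) = (\<Sum>x\<in>A. P (f x))" and
  P_uminus: "P (- x) = - P x" and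
  P_zero: "P 0 = 0"
  using P_linear unfolding linear_iff_module_hom
  by (simp_all add: module_hom.add module_hom.scale module_hom.sum module_hom.zero module_hom.neg)

lemma br_range_zero: "a \<in> range P \<Longrightarrow> b \<in> range P \<Longrightarrow> br a b = 0"
  using br_P_P by auto

lemma subspace_range: "subspace (range P)"
proof (rule subspaceI)
  show "0 \<in> range P" by (rule range_eqI[of _ _ 0]) (simp add: P_zero)
  show "x + y \<in> range P" if "x \<in> range P" "y \<in> range P" for x y
    using that by (auto simp flip: P_add)
  show "c *s x \<in> range P" if "x \<in> range P" for c x
    using that by (auto simp flip: P_scale)
qed

lemma super_vector_space_range: "super_vector_space scale (range P) (\<lambda>p. range P \<inter> G p)"
proof unfold_locales
  show "subspace (range P)" by (rule subspace_range)
  show "subspace (range P \<inter> G p)" for p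
    using subspace_range subspace_grade by (rule subspace_inter)
  show "range P \<inter> G 0 \<inter> (range P \<inter> G 1) = {0}"
    using grade_Int subspace_0[OF subspace_range] by auto
  show "range P = {x + y |x y. x \<in> range P \<inter> G 0 \<and> y \<in> range P \<inter> G 1}"
  proof (intro equalityI subsetI)
    fix v assume "v \<in> range P"
    then obtain z where v: "v = P z" by auto
    obtain z0 z1 where z: "z = z0 + z1" "z0 \<in> G 0" "z1 \<in> G 1" by (rule homogeneous_decomposition)
    have "v = P z0 + P z1" "P z0 \<in> range P \<inter> G 0" "P z1 \<in> range P \<inter> G 1"
      using P_grade[OF z(2)] P_grade[OF z(3)] by (simp_all add: v z(1) P_add)
    then show "v \<in> {x + y |x y. x \<in> range P \<inter> G 0 \<and> y \<in> range P \<inter> G 1}" by blast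
  qed (use subspace_add[OF subspace_range] in auto)
qed

text \<open>
  In the Leibniz rule the terms in which some \<open>b\<close> acts on \<open>v\<close> vanish, because the image of \<open>P\<close> is abelian.
\<close>

lemma foldl_br_br_range:
  assumes "v \<in> range P" "\<And>b. b \<in> set bs \<Longrightarrow> b \<in> range P \<and> (\<exists>r. b \<in> G r)" "x \<in> G q"
  shows "foldl br (br v x) bs = br v (foldl br x bs)"
  using assms(2,3)
proof (induction bs arbitrary: x q)
  case (Cons b bs)
  have "b \<in> range P \<and> (\<exists>r. b \<in> G r)" by (rule Cons.prems(1)) simp
  then obtain r where r: "b \<in> G r" and b: "b \<in> range P" by blast
  have "br (br v x) b = br v (br x b)"
    using br_br_right[OF Cons.prems(2) r, of v]
    by (simp add: br_range_zero[OF assms(1) b] br_zero_left)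
  then show ?case
    using Cons.IH[OF _ br_grade[OF Cons.prems(2) r]] Cons.prems(1) by simp
qed simp

lemma derived_bracket_symmetric:
  assumes "x \<in> range P \<inter> G p" "y \<in> range P \<inter> G q"
  shows "derived_bracket P br \<Delta> (as @ x # y # bs) =
    parity_sign (p * q) *s derived_bracket P br \<Delta> (as @ y # x # bs)"
proof -
  have "br x y = 0" using assms by (auto intro: br_range_zero)
  then have "br (br z x) y = parity_sign (p * q) *s br (br z y) x" for z
    using br_br_right[of x p y q z] br_add_right[of z 0 0] assms by simp
  then show ?thesis
    by (simp add: derived_bracket_def foldl_br_scale P_scale)
qed

text \<open>
  This identifies the summands of the Jacobi expression. The sign is that of the exchange of \<open>\<Delta>\<close> and
  \<open>P u\<close>: exponent \<open>1 + s\<close>, and one more from antisymmetry.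
\<close>

lemma derived_bracket_nested:
  assumes \<Delta>: "\<Delta> \<in> G 1" and u: "u \<in> G (1 + s)"
    and bs: "\<And>b. b \<in> set bs \<Longrightarrow> b \<in> range P \<and> (\<exists>r. b \<in> G r)"
  shows "derived_bracket P br \<Delta> (P u # bs) = parity_sign s *s P (br (P u) (foldl br \<Delta> bs))"
proof -
  have "br \<Delta> (P u) = - (parity_sign (1 * (1 + s)) *s br (P u) \<Delta>)"
    by (rule br_antisym[OF \<Delta> P_grade[OF u]])
  also have "\<dots> = parity_sign s *s br (P u) \<Delta>"
    by (cases s) (simp_all add: parity_sign_def)
  finally show ?thesis
    using foldl_br_br_range[OF rangeI[of P u] bs \<Delta>]
    by (simp add: derived_bracket_def foldl_br_scale P_scale)
qed

text \<open>
  The form in which the summands for complementary subsets are compared: with \<open>x = \<Delta>\<^bsub>S\<^esub>\<close> and \<open>y = \<Delta>\<^bsub>T\<^esub>\<close>,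
  the exponent \<open>s * t\<close> is the one by which the crossing exponents of \<open>(S, T)\<close> and \<open>(T, S)\<close> differ, so
  that \<open>t\<close> remains in the place of \<open>s\<close>.
\<close>

lemma P_br_homogeneous:
  assumes "x \<in> G (1 + s)" "y \<in> G (1 + t)"
  shows "parity_sign s *s P (br x y) = parity_sign s *s P (br (P x) y) +
    parity_sign (s * t + t) *s P (br (P y) x)"
proof -
  have "br x (P y) = - (parity_sign ((1 + s) * (1 + t)) *s br (P y) x)"
    by (rule br_antisym[OF assms(1) P_grade[OF assms(2)]])
  moreover have "parity_sign s * - parity_sign ((1 + s) * (1 + t)) = (parity_sign (s * t + t) :: 'k)"
    by (cases s; cases t) (simp_all add: parity_sign_def)
  ultimately show ?thesis
    by (subst P_br) (simp add: P_uminus P_scale scale_right_distrib flip: scale_minus_left)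
qed

lemma derived_bracket_jacobi:
  assumes \<Delta>: "\<Delta> \<in> G 1" and sq: "br \<Delta> \<Delta> = 0"
    and as: "list_all2 (\<lambda>a p. a \<in> range P \<inter> G p) as ps" and len: "length as = n"
  defines "B \<equiv> derived_bracket P br \<Delta>"
  shows "(\<Sum>k\<le>n. \<Sum>\<sigma>\<in>shuffle_perms k (n - k).
     parity_sign (koszul_exponent n ((!) ps) \<sigma>) *s
       B (B (map (\<lambda>i. as ! \<sigma> i) [0..<k]) # map (\<lambda>i. as ! \<sigma> i) [k..<n])) = 0"
    (is "?J = 0")
proof -
  define a where "a = (!) as"
  define p where "p = (!) ps"
  have a: "a i \<in> range P" "a i \<in> G (p i)" if "i < n" for i
    using list_all2_nthD[OF as] that len unfolding a_def p_def by auto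
  define D where "D = bracket_along a \<Delta>"
  define C where "C S = {..<n} - S" for S
  define \<epsilon> where "\<epsilon> S = crossing_exponent p S (C S)" for S
  define t where "t S = parity_sign (\<epsilon> S + sum p S) *s P (br (P (D S)) (D (C S)))" for S
  have D: "D S \<in> G (1 + sum p S)" if "S \<subseteq> {..<n}" for S
    unfolding D_def
    by (rule bracket_along_grade) (use that a \<Delta> in \<open>auto intro: finite_subset\<close>)
  have "?J = (\<Sum>k\<le>n. \<Sum>\<sigma>\<in>shuffle_perms k (n - k). parity_sign (koszul_exponent n p \<sigma>) *s
       B (B (map a (map \<sigma> [0..<k])) # map a (map \<sigma> [k..<n])))"
    by (simp add: a_def p_def comp_def)
  also have "\<dots> = (\<Sum>S\<in>Pow {..<n}. parity_sign (\<epsilon> S) *s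
       B (B (map a (sorted_list_of_set S)) # map a (sorted_list_of_set (C S))))"
    unfolding \<epsilon>_def C_def
    by (rule sum_shuffles_eq_sum_subsets
      [where F = "\<lambda>e us vs. parity_sign e *s B (B (map a us) # map a vs)"])
  also have "\<dots> = sum t (Pow {..<n})"
  proof (rule sum.cong[OF refl])
    fix S assume "S \<in> Pow {..<n}"
    then have S: "S \<subseteq> {..<n}" by simp
    have "B (map a (sorted_list_of_set S)) = P (D S)"
      by (simp add: B_def derived_bracket_def D_def bracket_along_def)
    moreover have "B (P (D S) # map a (sorted_list_of_set (C S))) =
        parity_sign (sum p S) *s P (br (P (D S)) (D (C S)))"
      unfolding B_def D_def[unfolded bracket_along_def, THEN fun_cong, of "C S"]
      by (rule derived_bracket_nested[OF \<Delta> D[OF S]]) (use a in \<open>auto simp: C_def\<close>)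
    ultimately show "parity_sign (\<epsilon> S) *s
        B (B (map a (sorted_list_of_set S)) # map a (sorted_list_of_set (C S))) = t S"
      by (simp add: t_def parity_sign_add del: add_bit_eq_xor)
  qed
  finally have J: "?J = sum t (Pow {..<n})" .
  \<comment> \<open>The same sum arises, doubled, from the expansion of the bracket of \<open>[\<Delta>, \<Delta>]\<close> with all \<open>a\<^sub>i\<close>.\<close>
  have "0 = P (foldl br (br \<Delta> \<Delta>) (map a [0..<n]))"
    by (simp add: sq foldl_br_zero P_zero)
  also have "\<dots> = (\<Sum>S\<in>Pow {..<n}. parity_sign (\<epsilon> S + sum p S) *s P (br (D S) (D (C S))))"
    by (subst foldl_br_br[OF a(2) \<Delta>])
      (simp_all add: P_sum P_scale \<epsilon>_def D_def C_def del: add_bit_eq_xor mult_bit_eq_and)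
  also have "\<dots> = (\<Sum>S\<in>Pow {..<n}. t S + t (C S))"
  proof (rule sum.cong[OF refl])
    fix S assume "S \<in> Pow {..<n}"
    then have S: "S \<subseteq> {..<n}" by simp
    have C: "C S \<subseteq> {..<n}" "C (C S) = S" using S by (auto simp: C_def)
    have "\<epsilon> S + \<epsilon> (C S) = sum p S * sum p (C S)"
      unfolding \<epsilon>_def C(2)
      by (rule crossing_exponent_swap) (use S in \<open>auto simp: C_def intro: finite_subset\<close>)
    then have "\<epsilon> S + sum p S * sum p (C S) = \<epsilon> S + (\<epsilon> S + \<epsilon> (C S))" by (simp only:)
    also have "\<dots> = \<epsilon> (C S)" by (simp only: add.assoc[symmetric] bit_add_self add_0)
    finally have e: "parity_sign (\<epsilon> S) * parity_sign (sum p S * sum p (C S) + sum p (C S)) =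
        (parity_sign (\<epsilon> (C S) + sum p (C S)) :: 'k)"
      by (simp only: parity_sign_add[symmetric] add.assoc[symmetric])
    have "parity_sign (\<epsilon> S + sum p S) *s P (br (D S) (D (C S))) =
        parity_sign (\<epsilon> S) *s (parity_sign (sum p S) *s P (br (D S) (D (C S))))"
      by (simp only: parity_sign_add scale_scale)
    then show "parity_sign (\<epsilon> S + sum p S) *s P (br (D S) (D (C S))) = t S + t (C S)"
      unfolding P_br_homogeneous[OF D[OF S] D[OF C(1)]] t_def C(2) e[symmetric]
      by (simp only: parity_sign_add scale_scale scale_right_distrib)
  qed
  also have "\<dots> = sum t (Pow {..<n}) + sum t (Pow {..<n})"
  proof -
    have "(\<Sum>S\<in>Pow {..<n}. t (C S)) = sum t (Pow {..<n})"
      by (rule sum.reindex_bij_witness[of _ C C]) (auto simp: C_def Diff_Diff_Int)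
    then show ?thesis by (simp add: sum.distrib)
  qed
  also have "\<dots> = (2 :: 'k) *s sum t (Pow {..<n})"
    by (simp only: one_add_one[symmetric] scale_left_distrib scale_one)
  finally show ?thesis
    unfolding J by simp
qed

theorem derived_brackets_L_infinity:
  assumes "\<Delta> \<in> G 1" "br \<Delta> \<Delta> = 0"
  shows "L_infinity_algebra scale (range P) (\<lambda>p. range P \<inter> G p) (derived_bracket P br \<Delta>)"
proof -
  interpret V: super_vector_space scale "range P" "\<lambda>p. range P \<inter> G p"
    by (rule super_vector_space_range)
  show ?thesis
  proof unfold_locales
    show "derived_bracket P br \<Delta> as \<in> range P \<inter> G (sum_list ps + 1)"
      if "list_all2 (\<lambda>a p. a \<in> range P \<inter> G p) as ps" for as ps
    proof -
      have "list_all2 (\<lambda>a p. a \<in> G p) as ps"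
        using that by (rule list_all2_mono) simp
      from P_grade[OF foldl_br_grade[OF this assms(1)]] show ?thesis
        by (simp add: derived_bracket_def add.commute del: add_bit_eq_xor)
    qed
    show "derived_bracket P br \<Delta> (as @ x # y # bs) =
        parity_sign (p * q) *s derived_bracket P br \<Delta> (as @ y # x # bs)"
      if "x \<in> range P \<inter> G p" "y \<in> range P \<inter> G q" for as bs x y p q
      using that by (rule derived_bracket_symmetric)
    show "(\<Sum>k\<le>n. \<Sum>\<sigma>\<in>shuffle_perms k (n - k). parity_sign (koszul_exponent n ((!) ps) \<sigma>) *s
        derived_bracket P br \<Delta> (derived_bracket P br \<Delta> (map (\<lambda>i. as ! \<sigma> i) [0..<k]) #
          map (\<lambda>i. as ! \<sigma> i) [k..<n])) = 0"
      if "list_all2 (\<lambda>a p. a \<in> range P \<inter> G p) as ps" "length as = n" for as ps n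
      using assms that by (rule derived_bracket_jacobi)
  qed (simp_all add: derived_bracket_def br_add_right br_scale_right foldl_br_add foldl_br_scale
        P_add P_scale)
qed

end

theorem corollary1:
  fixes scale :: "'k::field_char_0 \<Rightarrow> 'v::ab_group_add \<Rightarrow> 'v"
    and L :: "bit \<Rightarrow> 'v set"
    and br :: "'v \<Rightarrow> 'v \<Rightarrow> 'v"
    and P :: "'v \<Rightarrow> 'v"
    and \<Delta> :: 'v
  assumes "lie_superalgebra scale L br"
    and "Vector_Spaces.linear scale scale P"
    and "\<And>p. P ` L p \<subseteq> L p"
    and "P \<circ> P = P"
    and "\<And>a b. br (P a) (P b) = 0"
    and "\<And>a b. P (br a b) = P (br (P a) b) + P (br a (P b))"
    and "\<Delta> \<in> L 1"
    and "scale (1 / 2) (br \<Delta> \<Delta>) = 0"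
  shows "L_infinity_algebra scale (range P) (\<lambda>p. range P \<inter> L p) (derived_bracket P br \<Delta>)"
proof -
  interpret abelian_image_map scale L br P
  proof (intro abelian_image_map.intro abelian_image_map_axioms.intro)
    show "P x \<in> L p" if "x \<in> L p" for x p
      using assms(3) that by blast
  qed (rule assms)+
  have "br \<Delta> \<Delta> = 0"
    using assms(8) by simp
  with assms(7) show ?thesis
    by (rule derived_brackets_L_infinity)
qed

end
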